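(* Let $\mathsf{PT}$ be a process template synthesized, for a domain theory $\mathsf D$ and a process case $\mathsf C$, from a solution plan $\mathsf P=(A,O,CL)$ of the corresponding planning problem. Then all concurrent tasks of $\mathsf{PT}$ are independent: if $t_1$ and $t_2$ are concurrent tasks of $\mathsf{PT}$, then $t_1$ does not affect $t_2$ and $t_2$ does not affect $t_1$.
   Context: **Domain theory and tasks.** A domain theory $\mathsf D$ consists of finite data types of data objects, a finite set $\mathsf V$ of ground atomic terms, each with a Boolean, integer, or finite object-valued domain, and a set $\mathsf T$ of (ground) tasks. Each task $t$ has preconditions $Pre_t$, a conjunction of atomic conditions "$v\ \mathbf{op}\ expr$" with $v\in\mathsf V$ and $\mathbf{op}\in\{<,>,==,\le,\ge\}$ (only equality for Boolean and object-valued terms; negative preconditions are not allowed), and deterministic effects $Eff_t$, a conjunction of assignments "$v\ \mathbf{op}\ expr$" with $\mathbf{op}\in\{=,+=,-=\}$. A state is a complete assignment of values to the terms in $\mathsf V$; $state\vdash\chi$ means that the state satisfies $\chi$; $update(state,Eff_t)$ is the state obtained by applying the effects of $t$. A process case $\mathsf C$ consists of a starting condition $init_{\mathsf C}$ (a conjunction of assignments of values to some of the terms, possibly not all) and a goal condition $goal_{\mathsf C}$ (a conjunction of conditions with the syntax of preconditions). A case is translated into a planning problem with the same goal and a complete initial state, Boolean terms not mentioned in $init_{\mathsf C}$ being taken as false and other unmentioned terms as unassigned; tasks become planning actions with the same preconditions and effects. **Plans.** A partial plan is $\mathsf P=(A,O,CL)$: a set $A$ of actions containing the dummy actions $a_0$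 (whose effects are the facts true in the initial state of the problem) and $a_\infty$ (whose preconditions are the goal facts), with $a_0$ before and $a_\infty$ after all other actions; a set $O$ of ordering constraints $a\prec b$ ("$a$ is executed sometime before $b$"); and a set $CL$ of causal links $c\xrightarrow{p}d$, meaning that $p$ is an effect of $c$ and a precondition of $d$ and must remain true from $c$ to $d$ (in particular $c$ precedes $d$). The plan is consistent if $O$ has no cycles and there is no conflict with a causal link, i.e. for no causal link $c\xrightarrow{p}d$ is there another action of $A$ that can be ordered between $c$ and $d$ consistently with $O$ and makes $p$ false. An open condition is a precondition $p$ of some $a\in A$ for which there is no causal link $b\xrightarrow{p}a$ in $CL$. A solution plan is a consistent plan without open conditions. **Template.** The process template $\mathsf{PT}$ synthesized from $\mathsf P$ is the directed graph with a start event $\bigcirc$ (for $a_0$), an end event $\odot$ (for $a_\infty$), one task node for every other action of $A$, parallel split/join gateways, and transitions, which represents exactly the ordering constraints $O$. An execution path of $\mathsf{PT}$ is a linearization $[\bigcirc;t_1;\dots;t_k;\odot]$ of all its tasks consistent with the partial order given by the template (equivalently, with $O$). **Concurrency and independence.** Tasks $t_x$ and $t_z$ of $\mathsf{PT}$ are concurrent iff there are two execution paths of $\mathsf{PT}$, one in which $t_x$ occurs before $t_z$ and one in which $t_z$ occurs before $t_x$. Given an initial state $state_0\vdash init_{\mathsf C}$, a state is reachable with respect to $\mathsf{PT}$ iff it equals $update(\dots update(state_0,Eff_{t_1})\dots,Eff_{t_i})$ for some execution path $[\bigcirc;t_1;\dots;t_k;\odot]$ of $\mathsf{PT}$ and some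 $i\in\{1,\dots,k\}$. A task $t_1$ affects a task $t_2$ iff there is a state $state$, reachable with respect to $\mathsf{PT}$ for some initial state $state_0\vdash init_{\mathsf C}$, with $state\vdash Pre_{t_2}$ and $update(state,Eff_{t_1})\nvdash Pre_{t_2}$. Two concurrent tasks are independent iff neither affects the other. *)

theory Defs
  imports Main
begin

text \<open>
  Type variables: \<open>'v\<close> atomic terms, \<open>'o\<close> data objects, \<open>'d\<close> names of data types, \<open>'t\<close> tasks,
  \<open>'n\<close> occurrences of tasks in a plan, \<open>'g\<close> gateways.
\<close>

datatype 'd sort = BoolSort | IntSort | ObjSort 'd

text \<open>\<open>Unassigned\<close> is the value that the translation into a planning problem gives to the integer
  and object-valued terms on which the starting condition is silent.\<close>

datatype 'o val = BoolV bool | IntV int | ObjV 'o | Unassigned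

datatype ('v, 'o) expr =
    Val "'o val"
  | Term 'v
  | Plus "('v, 'o) expr" "('v, 'o) expr"
  | Minus "('v, 'o) expr" "('v, 'o) expr"
  | Times "('v, 'o) expr" "('v, 'o) expr"

datatype cond_op = Less | Greater | Equal | LessEq | GreaterEq
datatype assign_op = Set | Increase | Decrease

datatype ('v, 'o) cond = Cond 'v cond_op "('v, 'o) expr"
datatype ('v, 'o) assign = Assign 'v assign_op "('v, 'o) expr"

record ('d, 'o, 'v, 't) domain_theory =
  data_types :: "'d set"
  objects :: "'d \<Rightarrow> 'o set"
  atoms :: "'v set"
  sort_of :: "'v \<Rightarrow> 'd sort"
  tasks :: "'t set"
  Pre :: "'t \<Rightarrow> ('v, 'o) cond set"
  Eff :: "'t \<Rightarrow> ('v, 'o) assign list"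

type_synonym ('v, 'o) state = "'v \<Rightarrow> 'o val"

fun sort_values :: "('d, 'o, 'v, 't) domain_theory \<Rightarrow> 'd sort \<Rightarrow> 'o val set" where
  "sort_values D BoolSort = range BoolV"
| "sort_values D IntSort = range IntV"
| "sort_values D (ObjSort d) = ObjV ` objects D d"

fun expr_of_sort :: "('d, 'o, 'v, 't) domain_theory \<Rightarrow> 'd sort \<Rightarrow> ('v, 'o) expr \<Rightarrow> bool" where
  "expr_of_sort D \<tau> (Val x) \<longleftrightarrow> x \<in> sort_values D \<tau>"
| "expr_of_sort D \<tau> (Term v) \<longleftrightarrow> v \<in> atoms D \<and> sort_of D v = \<tau>"
| "expr_of_sort D \<tau> (Plus e f) \<longleftrightarrow> \<tau> = IntSort \<and> expr_of_sort D \<tau> e \<and> expr_of_sort D \<tau> f"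
| "expr_of_sort D \<tau> (Minus e f) \<longleftrightarrow> \<tau> = IntSort \<and> expr_of_sort D \<tau> e \<and> expr_of_sort D \<tau> f"
| "expr_of_sort D \<tau> (Times e f) \<longleftrightarrow> \<tau> = IntSort \<and> expr_of_sort D \<tau> e \<and> expr_of_sort D \<tau> f"

fun wf_cond :: "('d, 'o, 'v, 't) domain_theory \<Rightarrow> ('v, 'o) cond \<Rightarrow> bool" where
  "wf_cond D (Cond v oper e) \<longleftrightarrow>
     v \<in> atoms D \<and> expr_of_sort D (sort_of D v) e \<and> (oper \<noteq> Equal \<longrightarrow> sort_of D v = IntSort)"

fun wf_assign :: "('d, 'o, 'v, 't) domain_theory \<Rightarrow> ('v, 'o) assign \<Rightarrow> bool" where
  "wf_assign D (Assign v oper e) \<longleftrightarrow>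
     v \<in> atoms D \<and> expr_of_sort D (sort_of D v) e \<and> (oper \<noteq> Set \<longrightarrow> sort_of D v = IntSort)"

definition wf_domain :: "('d, 'o, 'v, 't) domain_theory \<Rightarrow> bool" where
  "wf_domain D \<longleftrightarrow>
     (\<forall>d\<in>data_types D. finite (objects D d)) \<and>
     finite (atoms D) \<and>
     (\<forall>v\<in>atoms D. \<forall>d. sort_of D v = ObjSort d \<longrightarrow> d \<in> data_types D) \<and>
     (\<forall>t\<in>tasks D. finite (Pre D t) \<and> (\<forall>p\<in>Pre D t. wf_cond D p) \<and>
                   (\<forall>a\<in>set (Eff D t). wf_assign D a))"

definition is_state :: "('d, 'o, 'v, 't) domain_theory \<Rightarrow> ('v, 'o) state \<Rightarrow> bool" where
  "is_state D s \<longleftrightarrow>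
     (\<forall>v\<in>atoms D. s v \<in> sort_values D (sort_of D v) \<or>
                    s v = Unassigned \<and> sort_of D v \<noteq> BoolSort)"

fun int_binop :: "(int \<Rightarrow> int \<Rightarrow> int) \<Rightarrow> 'o val \<Rightarrow> 'o val \<Rightarrow> 'o val" where
  "int_binop f (IntV i) (IntV j) = IntV (f i j)"
| "int_binop f _ _ = Unassigned"

fun int_rel :: "(int \<Rightarrow> int \<Rightarrow> bool) \<Rightarrow> 'o val \<Rightarrow> 'o val \<Rightarrow> bool" where
  "int_rel r (IntV i) (IntV j) \<longleftrightarrow> r i j"
| "int_rel r _ _ \<longleftrightarrow> False"

fun eval_expr :: "('v, 'o) state \<Rightarrow> ('v, 'o) expr \<Rightarrow> 'o val" where
  "eval_expr s (Val x) = x"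
| "eval_expr s (Term v) = s v"
| "eval_expr s (Plus e f) = int_binop (+) (eval_expr s e) (eval_expr s f)"
| "eval_expr s (Minus e f) = int_binop (-) (eval_expr s e) (eval_expr s f)"
| "eval_expr s (Times e f) = int_binop (*) (eval_expr s e) (eval_expr s f)"

fun sat_cond :: "('v, 'o) state \<Rightarrow> ('v, 'o) cond \<Rightarrow> bool" where
  "sat_cond s (Cond v Less e) \<longleftrightarrow> int_rel (<) (s v) (eval_expr s e)"
| "sat_cond s (Cond v Greater e) \<longleftrightarrow> int_rel (>) (s v) (eval_expr s e)"
| "sat_cond s (Cond v LessEq e) \<longleftrightarrow> int_rel (\<le>) (s v) (eval_expr s e)"
| "sat_cond s (Cond v GreaterEq e) \<longleftrightarrow> int_rel (\<ge>) (s v) (eval_expr s e)"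
| "sat_cond s (Cond v Equal e) \<longleftrightarrow> s v \<noteq> Unassigned \<and> s v = eval_expr s e"

definition sat :: "('v, 'o) state \<Rightarrow> ('v, 'o) cond set \<Rightarrow> bool" where
  "sat s \<chi> \<longleftrightarrow> (\<forall>p\<in>\<chi>. sat_cond s p)"

text \<open>The right-hand sides of a conjunction of effects are evaluated in the state \<open>s\<close> before the
  update. The order in which the assignments are listed matters only if several of them concern
  the same term and one of these is a \<open>Set\<close>.\<close>

fun apply_assign :: "('v, 'o) state \<Rightarrow> ('v, 'o) assign \<Rightarrow> ('v, 'o) state \<Rightarrow> ('v, 'o) state" where
  "apply_assign s (Assign v Set e) s' = s'(v := eval_expr s e)"
| "apply_assign s (Assign v Increase e) s' = s'(v := int_binop (+) (s' v) (eval_expr s e))"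
| "apply_assign s (Assign v Decrease e) s' = s'(v := int_binop (-) (s' v) (eval_expr s e))"

definition update :: "('v, 'o) state \<Rightarrow> ('v, 'o) assign list \<Rightarrow> ('v, 'o) state" where
  "update s effs = fold (apply_assign s) effs s"

record ('v, 'o) process_case =
  case_init :: "'v \<Rightarrow> 'o val option"
  case_goal :: "('v, 'o) cond set"

definition wf_case :: "('d, 'o, 'v, 't) domain_theory \<Rightarrow> ('v, 'o) process_case \<Rightarrow> bool" where
  "wf_case D C \<longleftrightarrow>
     (\<forall>v x. case_init C v = Some x \<longrightarrow> v \<in> atoms D \<and> x \<in> sort_values D (sort_of D v)) \<and>
     finite (case_goal C) \<and> (\<forall>p\<in>case_goal C. wf_cond D p)"

definition sat_init :: "('v, 'o) state \<Rightarrow> ('v, 'o) process_case \<Rightarrow> bool" where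
  "sat_init s C \<longleftrightarrow> (\<forall>v x. case_init C v = Some x \<longrightarrow> s v = x)"

record ('d, 'o, 'v, 't) planning_problem =
  prob_domain :: "('d, 'o, 'v, 't) domain_theory"
  prob_init :: "('v, 'o) state"
  prob_goal :: "('v, 'o) cond set"

definition problem_of ::
  "('d, 'o, 'v, 't) domain_theory \<Rightarrow> ('v, 'o) process_case \<Rightarrow> ('d, 'o, 'v, 't) planning_problem" where
  "problem_of D C =
     \<lparr> prob_domain = D,
       prob_init = (\<lambda>v. case case_init C v of
                          Some x \<Rightarrow> x
                        | None \<Rightarrow> (if sort_of D v = BoolSort then BoolV False else Unassigned)),
       prob_goal = case_goal C \<rparr>"

text \<open>\<open>Start\<close> and \<open>Finish\<close> are the dummy actions; every other action is an occurrence \<open>Occ n\<close> of the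
  task \<open>occ_task P n\<close>, so a task may occur more than once in a plan.\<close>

datatype 'n action = Start | Occ 'n | Finish

record ('v, 'o, 't, 'n) plan =
  occs :: "'n set"
  occ_task :: "'n \<Rightarrow> 't"
  orderings :: "('n action \<times> 'n action) set"
  links :: "('n action \<times> ('v, 'o) cond \<times> 'n action) set"

definition actions :: "('v, 'o, 't, 'n) plan \<Rightarrow> 'n action set" where
  "actions P = insert Start (insert Finish (Occ ` occs P))"

fun action_pre ::
  "('d, 'o, 'v, 't) planning_problem \<Rightarrow> ('v, 'o, 't, 'n) plan \<Rightarrow> 'n action \<Rightarrow> ('v, 'o) cond set" where
  "action_pre \<Pi> P Start = {}"
| "action_pre \<Pi> P (Occ n) = Pre (prob_domain \<Pi>) (occ_task P n)"
| "action_pre \<Pi> P Finish = prob_goal \<Pi>"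

fun action_result ::
  "('d, 'o, 'v, 't) planning_problem \<Rightarrow> ('v, 'o, 't, 'n) plan \<Rightarrow> 'n action \<Rightarrow>
   ('v, 'o) state \<Rightarrow> ('v, 'o) state" where
  "action_result \<Pi> P Start s = prob_init \<Pi>"
| "action_result \<Pi> P (Occ n) s = update s (Eff (prob_domain \<Pi>) (occ_task P n))"
| "action_result \<Pi> P Finish s = s"

fun assigned_term :: "('v, 'o) assign \<Rightarrow> 'v" where
  "assigned_term (Assign v oper e) = v"

fun action_assigns ::
  "('d, 'o, 'v, 't) planning_problem \<Rightarrow> ('v, 'o, 't, 'n) plan \<Rightarrow> 'n action \<Rightarrow> 'v set" where
  "action_assigns \<Pi> P Start = atoms (prob_domain \<Pi>)"
| "action_assigns \<Pi> P (Occ n) = assigned_term ` set (Eff (prob_domain \<Pi>) (occ_task P n))"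
| "action_assigns \<Pi> P Finish = {}"

fun expr_terms :: "('v, 'o) expr \<Rightarrow> 'v set" where
  "expr_terms (Val x) = {}"
| "expr_terms (Term v) = {v}"
| "expr_terms (Plus e f) = expr_terms e \<union> expr_terms f"
| "expr_terms (Minus e f) = expr_terms e \<union> expr_terms f"
| "expr_terms (Times e f) = expr_terms e \<union> expr_terms f"

fun cond_terms :: "('v, 'o) cond \<Rightarrow> 'v set" where
  "cond_terms (Cond v oper e) = insert v (expr_terms e)"

text \<open>
  Effects are assignments whereas preconditions may be numeric comparisons, so an effect need not
  literally be a precondition. A condition is an effect of an action if the action sets a term of
  the condition and the condition can hold as a result; an action makes a condition false if there
  is a state from which it does so. For conditions and effects that equate terms with constants,
  these say that the effects contain the condition, and that they contain an assignment conflicting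
  with it, respectively. The effects of \<open>Start\<close> are exactly the facts of the initial state.
\<close>

definition is_effect ::
  "('d, 'o, 'v, 't) planning_problem \<Rightarrow> ('v, 'o, 't, 'n) plan \<Rightarrow> 'n action \<Rightarrow> ('v, 'o) cond \<Rightarrow> bool" where
  "is_effect \<Pi> P a p \<longleftrightarrow>
     action_assigns \<Pi> P a \<inter> cond_terms p \<noteq> {} \<and>
     (\<exists>s. is_state (prob_domain \<Pi>) s \<and> sat_cond (action_result \<Pi> P a s) p)"

definition makes_false ::
  "('d, 'o, 'v, 't) planning_problem \<Rightarrow> ('v, 'o, 't, 'n) plan \<Rightarrow> 'n action \<Rightarrow> ('v, 'o) cond \<Rightarrow> bool" where
  "makes_false \<Pi> P a p \<longleftrightarrow>
     (\<exists>s. is_state (prob_domain \<Pi>) s \<and> sat_cond s p \<and> \<not> sat_cond (action_result \<Pi> P a s) p)"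

definition partial_plan ::
  "('d, 'o, 'v, 't) planning_problem \<Rightarrow> ('v, 'o, 't, 'n) plan \<Rightarrow> bool" where
  "partial_plan \<Pi> P \<longleftrightarrow>
     finite (occs P) \<and> occ_task P ` occs P \<subseteq> tasks (prob_domain \<Pi>) \<and>
     orderings P \<subseteq> actions P \<times> actions P \<and>
     (\<forall>a\<in>actions P. a \<noteq> Start \<longrightarrow> (Start, a) \<in> (orderings P)\<^sup>+) \<and>
     (\<forall>a\<in>actions P. a \<noteq> Finish \<longrightarrow> (a, Finish) \<in> (orderings P)\<^sup>+) \<and>
     (\<forall>(c, p, d)\<in>links P. c \<in> actions P \<and> d \<in> actions P \<and>
        is_effect \<Pi> P c p \<and> p \<in> action_pre \<Pi> P d \<and> (c, d) \<in> (orderings P)\<^sup>+)"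

definition consistent ::
  "('d, 'o, 'v, 't) planning_problem \<Rightarrow> ('v, 'o, 't, 'n) plan \<Rightarrow> bool" where
  "consistent \<Pi> P \<longleftrightarrow>
     acyclic (orderings P) \<and>
     (\<forall>(c, p, d)\<in>links P.
        \<not> (\<exists>a\<in>actions P - {c, d}.
             acyclic (orderings P \<union> {(c, a), (a, d)}) \<and> makes_false \<Pi> P a p))"

definition open_condition ::
  "('d, 'o, 'v, 't) planning_problem \<Rightarrow> ('v, 'o, 't, 'n) plan \<Rightarrow> 'n action \<Rightarrow> ('v, 'o) cond \<Rightarrow> bool" where
  "open_condition \<Pi> P a p \<longleftrightarrow>
     a \<in> actions P \<and> p \<in> action_pre \<Pi> P a \<and> \<not> (\<exists>b. (b, p, a) \<in> links P)"

definition solution_plan ::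
  "('d, 'o, 'v, 't) planning_problem \<Rightarrow> ('v, 'o, 't, 'n) plan \<Rightarrow> bool" where
  "solution_plan \<Pi> P \<longleftrightarrow>
     partial_plan \<Pi> P \<and> consistent \<Pi> P \<and> \<not> (\<exists>a p. open_condition \<Pi> P a p)"

datatype ('n, 'g) node =
    StartEvent | EndEvent | TaskNode 'n | ParallelSplit 'g | ParallelJoin 'g

record ('t, 'n, 'g) template =
  nodes :: "('n, 'g) node set"
  transitions :: "(('n, 'g) node \<times> ('n, 'g) node) set"
  node_task :: "'n \<Rightarrow> 't"

definition template_tasks :: "('t, 'n, 'g) template \<Rightarrow> 'n set" where
  "template_tasks PT = {n. TaskNode n \<in> nodes PT}"

fun node_of :: "'n action \<Rightarrow> ('n, 'g) node" where
  "node_of Start = StartEvent"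
| "node_of (Occ n) = TaskNode n"
| "node_of Finish = EndEvent"

text \<open>A template contains the events and the task nodes for the actions of the plan, and between
  these its transitions (possibly through gateways) represent exactly the order of the plan.\<close>

definition synthesized_from :: "('t, 'n, 'g) template \<Rightarrow> ('v, 'o, 't, 'n) plan \<Rightarrow> bool" where
  "synthesized_from PT P \<longleftrightarrow>
     finite (nodes PT) \<and> transitions PT \<subseteq> nodes PT \<times> nodes PT \<and>
     StartEvent \<in> nodes PT \<and> EndEvent \<in> nodes PT \<and> template_tasks PT = occs P \<and>
     (\<forall>n\<in>occs P. node_task PT n = occ_task P n) \<and>
     (\<forall>a\<in>actions P. \<forall>b\<in>actions P.
        (node_of a, node_of b) \<in> (transitions PT)\<^sup>+ \<longleftrightarrow> (a, b) \<in> (orderings P)\<^sup>+)"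

text \<open>The list \<open>ts\<close> of task nodes stands for the path from the start event through \<open>ts\<close> to the end
  event.\<close>

definition execution_path :: "('t, 'n, 'g) template \<Rightarrow> 'n list \<Rightarrow> bool" where
  "execution_path PT ts \<longleftrightarrow>
     distinct ts \<and> set ts = template_tasks PT \<and>
     (let \<pi> = StartEvent # map TaskNode ts @ [EndEvent] in
        \<forall>i < length \<pi>. \<forall>j < length \<pi>. (\<pi> ! i, \<pi> ! j) \<in> (transitions PT)\<^sup>+ \<longrightarrow> i < j)"

definition occurs_before :: "'n list \<Rightarrow> 'n \<Rightarrow> 'n \<Rightarrow> bool" where
  "occurs_before ts x z \<longleftrightarrow> (\<exists>i j. i < j \<and> j < length ts \<and> ts ! i = x \<and> ts ! j = z)"

definition concurrent :: "('t, 'n, 'g) template \<Rightarrow> 'n \<Rightarrow> 'n \<Rightarrow> bool" where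
  "concurrent PT x z \<longleftrightarrow>
     (\<exists>ts. execution_path PT ts \<and> occurs_before ts x z) \<and>
     (\<exists>ts. execution_path PT ts \<and> occurs_before ts z x)"

definition reachable_from ::
  "('d, 'o, 'v, 't) domain_theory \<Rightarrow> ('t, 'n, 'g) template \<Rightarrow>
   ('v, 'o) state \<Rightarrow> ('v, 'o) state \<Rightarrow> bool" where
  "reachable_from D PT s0 s \<longleftrightarrow>
     (\<exists>ts i. execution_path PT ts \<and> 1 \<le> i \<and> i \<le> length ts \<and>
        s = foldl (\<lambda>s n. update s (Eff D (node_task PT n))) s0 (take i ts))"

definition affects ::
  "('d, 'o, 'v, 't) domain_theory \<Rightarrow> ('v, 'o) process_case \<Rightarrow> ('t, 'n, 'g) template \<Rightarrow>
   'n \<Rightarrow> 'n \<Rightarrow> bool" where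
  "affects D C PT x z \<longleftrightarrow>
     (\<exists>s0 s. is_state D s0 \<and> sat_init s0 C \<and> reachable_from D PT s0 s \<and>
        sat s (Pre D (node_task PT z)) \<and>
        \<not> sat (update s (Eff D (node_task PT x))) (Pre D (node_task PT z)))"

definition independent ::
  "('d, 'o, 'v, 't) domain_theory \<Rightarrow> ('v, 'o) process_case \<Rightarrow> ('t, 'n, 'g) template \<Rightarrow>
   'n \<Rightarrow> 'n \<Rightarrow> bool" where
  "independent D C PT x z \<longleftrightarrow> \<not> affects D C PT x z \<and> \<not> affects D C PT z x"

end

theory Submission
  imports Defs
begin

text \<open>
  Suppose \<open>t\<^sub>1\<close> falsifies a precondition \<open>p\<close> of a concurrent task \<open>t\<^sub>2\<close> in a reachable state. The plan
  has no open conditions, so some causal link protects \<open>p\<close> from a producer \<open>c\<close> up to \<open>t\<^sub>2\<close>. Since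
  \<open>t\<^sub>1\<close> is unordered with respect to \<open>t\<^sub>2\<close>, it is neither \<open>c\<close> nor before \<open>c\<close>, so it can be ordered
  between \<open>c\<close> and \<open>t\<^sub>2\<close>; this is a conflict with the link, and the plan is not consistent.
\<close>

lemma int_binop_of_int_sort:
  "int_binop f x y \<in> sort_values D IntSort \<or> int_binop f x y = Unassigned"
  by (cases x; cases y) auto

text \<open>The sort \<open>BoolSort\<close> admits no arithmetic, so \<open>Unassigned\<close> can
  arise only from integer operations or from terms that are not Boolean.\<close>

lemma eval_expr_of_sort:
  assumes "is_state D s" "expr_of_sort D \<tau> e"
  shows "eval_expr s e \<in> sort_values D \<tau> \<or> eval_expr s e = Unassigned \<and> \<tau> \<noteq> BoolSort"
  using assms(2)
proof (induction e)
  case (Term v)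
  then show ?case using assms(1) by (auto simp: is_state_def)
qed (auto simp: int_binop_of_int_sort simp del: sort_values.simps)

lemma is_state_apply_assign:
  assumes "is_state D s" "is_state D s'" "wf_assign D a"
  shows "is_state D (apply_assign s a s')"
proof (cases a)
  case (Assign v oper e)
  then have "expr_of_sort D (sort_of D v) e"
    and int: "oper \<noteq> Set \<Longrightarrow> sort_of D v = IntSort"
    using assms(3) by auto
  then have "eval_expr s e \<in> sort_values D (sort_of D v) \<or>
      eval_expr s e = Unassigned \<and> sort_of D v \<noteq> BoolSort"
    using eval_expr_of_sort assms(1) by blast
  \<comment> \<open>\<open>Set\<close> passes on the value of the right-hand side;
    \<open>Increase\<close> and \<open>Decrease\<close> are confined to integer terms, where
    \<open>int_binop\<close> yields an integer or \<open>Unassigned\<close>.\<close>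
  then show ?thesis
    using assms(2) int unfolding Assign is_state_def
    by (cases oper) (simp_all add: int_binop_of_int_sort del: sort_values.simps)
qed

lemma is_state_update:
  assumes "is_state D s" "\<forall>a\<in>set effs. wf_assign D a"
  shows "is_state D (update s effs)"
proof -
  \<comment> \<open>Right-hand sides are always evaluated in the fixed \<open>s\<close>, while the
    fold changes its accumulator; the induction therefore needs an arbitrary start
    \<open>s'\<close>.\<close>
  have "is_state D (fold (apply_assign s) effs s')" if "is_state D s'" for s'
    using that assms(2)
    by (induction effs arbitrary: s') (auto intro: is_state_apply_assign[OF assms(1)])
  then show ?thesis using assms(1) by (simp add: update_def)
qed

text \<open>\<open>makes_false\<close> asks for a witness satisfying \<open>is_state\<close>; this
  lets a reachable state serve as one.\<close>

lemma is_state_reachable: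
  assumes wf: "\<And>n a. n \<in> template_tasks PT \<Longrightarrow> a \<in> set (Eff D (node_task PT n)) \<Longrightarrow> wf_assign D a"
    and "is_state D s0" "reachable_from D PT s0 s"
  shows "is_state D s"
proof -
  obtain ts i where ts: "execution_path PT ts"
    and s: "s = foldl (\<lambda>s n. update s (Eff D (node_task PT n))) s0 (take i ts)"
    using assms(3) by (auto simp: reachable_from_def)
  have "is_state D (foldl (\<lambda>s n. update s (Eff D (node_task PT n))) s0 ns)"
    if "set ns \<subseteq> template_tasks PT" for ns
    using that assms(2)
    by (induction ns arbitrary: s0) (auto intro: is_state_update wf)
  moreover have "set (take i ts) \<subseteq> template_tasks PT"
    using ts set_take_subset[of i ts] by (auto simp: execution_path_def)
  ultimately show ?thesis using s by simp
qed

lemma occurs_before_not_reverse_ordered: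
  fixes PT :: "('t, 'n, 'g) template"
  assumes "execution_path PT ts" "occurs_before ts x z"
  shows "x \<in> template_tasks PT" "z \<in> template_tasks PT" "x \<noteq> z"
    "(TaskNode z, TaskNode x) \<notin> (transitions PT)\<^sup>+"
proof -
  obtain i j where ij: "i < j" "j < length ts" "ts ! i = x" "ts ! j = z"
    using assms(2) unfolding occurs_before_def by blast
  then have "i < length ts" by simp
  have path: "distinct ts" "set ts = template_tasks PT"
    using assms(1) unfolding execution_path_def by blast+
  show "x \<in> template_tasks PT" "z \<in> template_tasks PT"
    using nth_mem[OF \<open>i < length ts\<close>] nth_mem[OF ij(2)] path(2) ij(3,4) by simp_all
  show "x \<noteq> z"
    using nth_eq_iff_index_eq[OF path(1) \<open>i < length ts\<close> ij(2)] ij(1,3,4) by simp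
  define \<pi> :: "('n, 'g) node list" where "\<pi> = StartEvent # map TaskNode ts @ [EndEvent]"
  have "\<forall>i < length \<pi>. \<forall>j < length \<pi>. (\<pi> ! i, \<pi> ! j) \<in> (transitions PT)\<^sup>+ \<longrightarrow> i < j"
    using assms(1) unfolding execution_path_def Let_def \<pi>_def by blast
  \<comment> \<open>The start event occupies position 0 of \<open>\<pi>\<close>, which shifts every
    task position by one.\<close>
  moreover have "Suc j < length \<pi>" "Suc i < length \<pi>"
    using ij(2) \<open>i < length ts\<close> by (simp_all add: \<pi>_def)
  ultimately have "(\<pi> ! Suc j, \<pi> ! Suc i) \<in> (transitions PT)\<^sup>+ \<longrightarrow> Suc j < Suc i"
    by blast
  moreover have "\<pi> ! Suc j = TaskNode z" "\<pi> ! Suc i = TaskNode x"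
    using ij \<open>i < length ts\<close> by (simp_all add: \<pi>_def nth_append)
  ultimately show "(TaskNode z, TaskNode x) \<notin> (transitions PT)\<^sup>+"
    using ij(1) by simp
qed

text \<open>Each of the two paths rules out one direction of the order on template nodes; synthesis
  transfers this, across any gateways, to the order of the plan.\<close>

lemma concurrent_unordered:
  assumes "synthesized_from PT P" "concurrent PT x z"
  shows "x \<in> occs P" "z \<in> occs P" "x \<noteq> z"
    "(Occ x, Occ z) \<notin> (orderings P)\<^sup>+" "(Occ z, Occ x) \<notin> (orderings P)\<^sup>+"
proof -
  obtain ts ts' where ts: "execution_path PT ts" "occurs_before ts x z"
    and ts': "execution_path PT ts'" "occurs_before ts' z x"
    using assms(2) by (auto simp: concurrent_def)
  have "template_tasks PT = occs P"
    using assms(1) by (simp add: synthesized_from_def)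
  then show xz: "x \<in> occs P" "z \<in> occs P" "x \<noteq> z"
    using occurs_before_not_reverse_ordered(1-3)[OF ts] by simp_all
  have "(Occ a, Occ b) \<in> (orderings P)\<^sup>+ \<longleftrightarrow> (TaskNode a, TaskNode b) \<in> (transitions PT)\<^sup>+"
    if "a \<in> occs P" "b \<in> occs P" for a b
  proof -
    have "Occ a \<in> actions P" "Occ b \<in> actions P"
      using that by (auto simp: actions_def)
    then show ?thesis
      using assms(1) unfolding synthesized_from_def by (metis node_of.simps(2))
  qed
  then show "(Occ x, Occ z) \<notin> (orderings P)\<^sup>+" "(Occ z, Occ x) \<notin> (orderings P)\<^sup>+"
    using xz occurs_before_not_reverse_ordered(4)[OF ts] occurs_before_not_reverse_ordered(4)[OF ts']
    by simp_all
qed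

text \<open>A cycle using a new edge would require an \<open>r\<close>-path from \<open>d\<close> to
  \<open>a\<close>, from \<open>d\<close> to \<open>c\<close>, or from \<open>a\<close> to
  \<open>c\<close>. The second closes a cycle with the path from \<open>c\<close> to
  \<open>d\<close>; the third extends along that path to put \<open>a\<close> before
  \<open>d\<close>.\<close>

lemma acyclic_insert_between:
  assumes "acyclic r" "(c, d) \<in> r\<^sup>+" "a \<noteq> d" "(a, d) \<notin> r\<^sup>+" "(d, a) \<notin> r\<^sup>+"
  shows "acyclic (r \<union> {(c, a), (a, d)})"
proof -
  have "(d, a) \<notin> r\<^sup>*"
    using assms(3,5) by (auto simp: rtrancl_eq_or_trancl)
  moreover have "(d, c) \<notin> r\<^sup>*"
    using assms(1,2) by (meson acyclic_def rtrancl_trancl_trancl)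
  moreover have "(a, c) \<notin> r\<^sup>*"
    using assms(2,4) by (meson rtrancl_trancl_trancl)
  ultimately have "acyclic (insert (c, a) (insert (a, d) r))"
    using assms(1) by (auto simp: rtrancl_insert)
  then show ?thesis by (simp add: insert_commute)
qed

lemma concurrent_not_affects:
  assumes "wf_domain D" "solution_plan (problem_of D C) P"
    and "synthesized_from PT P" "concurrent PT x z"
  shows "\<not> affects D C PT x z"
proof
  assume "affects D C PT x z"
  \<comment> \<open>A precondition is a conjunction, so its loss is the loss of a single conjunct
    \<open>p\<close>.\<close>
  then obtain s0 s p where "is_state D s0" "reachable_from D PT s0 s"
    and p: "p \<in> Pre D (node_task PT z)" "sat_cond s p"
      "\<not> sat_cond (update s (Eff D (node_task PT x))) p"
    by (auto simp: affects_def sat_def)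
  have dom: "prob_domain (problem_of D C) = D" by (simp add: problem_of_def)
  note xz = concurrent_unordered[OF assms(3,4)]
  have plan: "partial_plan (problem_of D C) P" "consistent (problem_of D C) P"
    "\<not> open_condition (problem_of D C) P a q" for a q
    using assms(2) by (auto simp: solution_plan_def)
  have task: "node_task PT n = occ_task P n" if "n \<in> occs P" for n
    using assms(3) that by (simp add: synthesized_from_def)
  have "wf_assign D a" if "n \<in> template_tasks PT" "a \<in> set (Eff D (node_task PT n))" for n a
  proof -
    have "n \<in> occs P" using that(1) assms(3) by (simp add: synthesized_from_def)
    moreover from this have "occ_task P n \<in> tasks D"
      using plan(1) by (auto simp: partial_plan_def dom)
    ultimately show ?thesis
      using that(2) assms(1) task by (auto simp: wf_domain_def)
  qed
  then have "is_state D s"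
    using is_state_reachable \<open>is_state D s0\<close> \<open>reachable_from D PT s0 s\<close> by blast
  then have false: "makes_false (problem_of D C) P (Occ x) p"
    using p(2,3) xz(1) task by (auto simp: makes_false_def dom)
  have "Occ z \<in> actions P" "Occ x \<in> actions P"
    using xz by (auto simp: actions_def)
  moreover have "p \<in> action_pre (problem_of D C) P (Occ z)"
    using p(1) xz(2) task by (simp add: dom)
  ultimately obtain c where link: "(c, p, Occ z) \<in> links P"
    using plan(3) unfolding open_condition_def by blast
  then have cz: "(c, Occ z) \<in> (orderings P)\<^sup>+"
    using plan(1) by (auto simp: partial_plan_def)
  \<comment> \<open>If \<open>c\<close> were \<open>Occ x\<close>, then \<open>cz\<close> would
    order \<open>x\<close> before \<open>z\<close>, against concurrency.\<close>
  then have "Occ x \<in> actions P - {c, Occ z}"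
    using xz \<open>Occ x \<in> actions P\<close> by auto
  moreover have "acyclic (orderings P \<union> {(c, Occ x), (Occ x, Occ z)})"
    using plan(2) cz xz by (intro acyclic_insert_between) (auto simp: consistent_def)
  ultimately show False
    using plan(2) link false unfolding consistent_def by blast
qed

theorem theorem6:
  fixes D :: "('d, 'o, 'v, 't) domain_theory"
    and C :: "('v, 'o) process_case"
    and P :: "('v, 'o, 't, 'n) plan"
    and PT :: "('t, 'n, 'g) template"
    and t1 t2 :: 'n
  assumes "wf_domain D" and "wf_case D C"
    and "solution_plan (problem_of D C) P"
    and "synthesized_from PT P"
    and "concurrent PT t1 t2"
  shows "independent D C PT t1 t2"
proof -
  \<comment> \<open>Concurrency is symmetric, so the one-sided result applies in both
    directions.\<close>
  have "concurrent PT t2 t1"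
    using assms(5) by (auto simp: concurrent_def)
  then show ?thesis
    using concurrent_not_affects[OF assms(1,3,4)] assms(5) by (simp add: independent_def)
qed

end
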